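(* Let $(X,d)$ be a metric space and let $F$ be a control function. If $X$ is proper, then $\overline{\mathcal D}_F$, with the metric $\rho$, is compact.
   Context: A discrete subset $D\subset X$ is $r$-discrete if $d(x,y)\ge r$ for all $x,y\in D$ with $x\ne y$. It is $R$-dense if for every $x\in X$ there is $y\in D$ with $d(x,y)\le R$. It is an $(r,R)$-Delone set if it is both $r$-discrete and $R$-dense, and a Delone set if it is an $(r,R)$-Delone set for some $r,R>0$. For a Delone set $D$ put $r(D)=\inf_{x,y\in D,\,x\ne y}d(x,y)$ and $R(D)=\inf\{R: D\text{ is }R\text{-dense}\}$. A control function is a monotone continuous function $F:[0,1]\to[0,1]$ such that $F(0)=0$. A Delone set $D$ is controlled by $F$ if $R(D)\ge R$ implies $r(D)\ge F(R)$ (for $R\in[0,1]$, the domain of $F$). $\mathcal D_F$ is the set of all Delone sets $D\subset X$ with $R(D)\le 1$ that are controlled by $F$, and $\overline{\mathcal D}_F=\mathcal D_F\cup\{X\}$. Fix a point $x_0\in X$. $B_r(x_0)$ denotes the open ball of radius $r$ centered at $x_0$, and $A^{(+\varepsilon)}$ denotes the $\varepsilon$-neighborhood of a set $A\subset X$. The metric $\rho$ on $\overline{\mathcal D}_F$ is defined by $$\rho(D_1,D_2)=\inf\left(\{\varepsilon>0: D_1\cap B_{1/\varepsilon}(x_0)\subset D_2^{(+\varepsilon)},\ D_2\cap B_{1/\varepsilon}(x_0)\subset D_1^{(+\varepsilon)}\}\cup\{1\}\right).$$ A metric space is proper if its closed balls are compact.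
   Formalization: The formal theorem also assumes that the control function satisfies F(R) > 0 for all R in (0,1] (automatic if "monotone" means strictly monotone); without this the claim fails, e.g. for F = 0 and X the real line. *)

theory Defs
  imports "HOL-Analysis.Analysis"
begin

definition r_discrete :: "real \<Rightarrow> 'a::metric_space set \<Rightarrow> bool" where
  "r_discrete r D \<longleftrightarrow> discrete D \<and> (\<forall>x\<in>D. \<forall>y\<in>D. x \<noteq> y \<longrightarrow> dist x y \<ge> r)"

definition R_dense :: "real \<Rightarrow> 'a::metric_space set \<Rightarrow> bool" where
  "R_dense R D \<longleftrightarrow> (\<forall>x. \<exists>y\<in>D. dist x y \<le> R)"

definition delone :: "'a::metric_space set \<Rightarrow> bool" where
  "delone D \<longleftrightarrow> (\<exists>r>0. \<exists>R>0. r_discrete r D \<and> R_dense R D)"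

text \<open>
  Both radii are taken in the extended reals because \<open>r(D)\<close> is an infimum over the empty set,
  i.e. \<open>\<infinity>\<close>, when \<open>D\<close> is a single point (a Delone set if the space is bounded).
\<close>

definition sep_radius :: "'a::metric_space set \<Rightarrow> ereal" where
  "sep_radius D = Inf {ereal (dist x y) | x y. x \<in> D \<and> y \<in> D \<and> x \<noteq> y}"

definition cov_radius :: "'a::metric_space set \<Rightarrow> ereal" where
  "cov_radius D = Inf {ereal R | R. R_dense R D}"

text \<open>Functions on \<open>[0,1]\<close> are total on \<open>real\<close>; their values outside \<open>[0,1]\<close> are never used.\<close>

definition control_function :: "(real \<Rightarrow> real) \<Rightarrow> bool" where
  "control_function F \<longleftrightarrow>
     F \<in> {0..1} \<rightarrow> {0..1} \<and> mono_on {0..1} F \<and> continuous_on {0..1} F \<and> F 0 = 0"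

definition controlled_by :: "(real \<Rightarrow> real) \<Rightarrow> 'a::metric_space set \<Rightarrow> bool" where
  "controlled_by F D \<longleftrightarrow>
     (\<forall>R\<in>{0..1}. cov_radius D \<ge> ereal R \<longrightarrow> sep_radius D \<ge> ereal (F R))"

definition delone_sets :: "(real \<Rightarrow> real) \<Rightarrow> 'a::metric_space set set" where
  "delone_sets F = {D. delone D \<and> cov_radius D \<le> 1 \<and> controlled_by F D}"

definition delone_sets_bar :: "(real \<Rightarrow> real) \<Rightarrow> 'a::metric_space set set" where
  "delone_sets_bar F = delone_sets F \<union> {UNIV}"

definition nbhd :: "real \<Rightarrow> 'a::metric_space set \<Rightarrow> 'a set" where
  "nbhd e A = (\<Union>a\<in>A. ball a e)"

definition rho :: "'a::metric_space \<Rightarrow> 'a set \<Rightarrow> 'a set \<Rightarrow> real" where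
  "rho x0 D1 D2 =
     Inf ({e. e > 0 \<and> D1 \<inter> ball x0 (1 / e) \<subseteq> nbhd e D2 \<and> D2 \<inter> ball x0 (1 / e) \<subseteq> nbhd e D1}
          \<union> {1})"

definition proper_metric :: "'a::metric_space itself \<Rightarrow> bool" where
  "proper_metric _ \<longleftrightarrow> (\<forall>(x::'a) r. compact (cball x r))"

end

theory Submission
  imports Defs "HOL-Complex_Analysis.Great_Picard"
begin

text \<open>
  A closed set \<open>D\<close> is encoded by its distance function \<open>infdist _ D\<close>, which is 1-Lipschitz and, when
  \<open>cov_radius D \<le> 1\<close>, takes values in \<open>[0,1]\<close>. By a diagonal argument and the Lipschitz bound, any
  sequence of such functions has a subsequence that converges locally uniformly, and properness
  makes the limit the distance function of its own zero set. Locally uniform convergence of the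
  distance functions implies convergence for \<open>rho\<close>. Finally the class is closed under such limits,
  because it consists exactly of the closed controlled sets of covering radius at most 1: a
  controlled set of positive covering radius is uniformly discrete, and a closed set of covering
  radius 0 is the whole space.
\<close>

section \<open>Covering and separation radii in terms of distances\<close>

lemma infdist_less_iff:
  "A \<noteq> {} \<Longrightarrow> infdist x A < e \<longleftrightarrow> (\<exists>a\<in>A. dist x a < e)"
  unfolding infdist_notempty by (rule cINF_less_iff) (auto intro!: bdd_belowI2)

lemma mem_nbhd_iff: "x \<in> nbhd e A \<longleftrightarrow> (\<exists>a\<in>A. dist x a < e)"
  by (auto simp: nbhd_def dist_commute)

lemma nbhd_eq_infdist: "A \<noteq> {} \<Longrightarrow> nbhd e A = {x. infdist x A < e}"
  by (auto simp: mem_nbhd_iff infdist_less_iff)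

text \<open>The infimum need not be attained, so \<open>R_dense R D\<close> may fail at the covering
  radius itself; bounding \<open>infdist\<close> absorbs this. Nonemptiness is stated separately
  because \<open>infdist x {} = 0\<close> by convention, while \<open>{}\<close> has infinite
  covering radius.\<close>

lemma cov_radius_le_iff:
  "cov_radius D \<le> ereal R \<longleftrightarrow> D \<noteq> {} \<and> (\<forall>x. infdist x D \<le> R)"
proof
  assume le: "cov_radius D \<le> ereal R"
  have dense: "\<exists>S<R'. R_dense S D" if "R < R'" for R'
  proof -
    have "cov_radius D < ereal R'"
      using le that by (meson ereal_less(2) less_ereal.simps(1) order_le_less_trans)
    then show ?thesis
      unfolding cov_radius_def Inf_less_iff by auto
  qed
  then have "D \<noteq> {}"
    unfolding R_dense_def by (metis empty_iff gt_ex)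
  moreover have "infdist x D \<le> R" for x
  proof (rule dense_ge)
    fix R' assume "R < R'"
    then obtain S y where "S < R'" "y \<in> D" "dist x y \<le> S"
      using dense unfolding R_dense_def by meson
    then show "infdist x D \<le> R'"
      using infdist_le[of y D x] by linarith
  qed
  ultimately show "D \<noteq> {} \<and> (\<forall>x. infdist x D \<le> R)" by blast
next
  assume D: "D \<noteq> {} \<and> (\<forall>x. infdist x D \<le> R)"
  show "cov_radius D \<le> ereal R"
  proof (rule ereal_le_epsilon2)
    fix e :: real assume "0 < e"
    then have "R_dense (R + e) D"
      using D unfolding R_dense_def
      by (metis infdist_less_iff less_add_same_cancel1
          less_imp_le order_le_less_trans)
    then show "cov_radius D \<le> ereal R + ereal e"
      unfolding cov_radius_def by (auto intro: Inf_lower)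
  qed
qed

lemma cov_radius_nonneg: "0 \<le> cov_radius D"
  unfolding cov_radius_def
proof (rule Inf_greatest, clarify)
  fix R assume "R_dense R D"
  then obtain x y :: 'a where "dist x y \<le> R"
    unfolding R_dense_def by blast
  then have "0 \<le> R" by (rule order_trans[OF zero_le_dist])
  then show "0 \<le> ereal R" by simp
qed

lemma le_sep_radius_iff:
  "ereal r \<le> sep_radius D \<longleftrightarrow> (\<forall>x\<in>D. \<forall>y\<in>D. x \<noteq> y \<longrightarrow> r \<le> dist x y)"
proof
  assume le: "ereal r \<le> sep_radius D"
  show "\<forall>x\<in>D. \<forall>y\<in>D. x \<noteq> y \<longrightarrow> r \<le> dist x y"
  proof (intro ballI impI)
    fix x y assume "x \<in> D" "y \<in> D" "x \<noteq> y"
    then have "sep_radius D \<le> ereal (dist x y)"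
      unfolding sep_radius_def by (intro Inf_lower) blast
    with le show "r \<le> dist x y"
      by (metis ereal_less_eq(3) order_trans)
  qed
next
  assume "\<forall>x\<in>D. \<forall>y\<in>D. x \<noteq> y \<longrightarrow> r \<le> dist x y"
  then show "ereal r \<le> sep_radius D"
    unfolding sep_radius_def by (intro Inf_greatest) auto
qed

lemma controlled_by_iff:
  "controlled_by F D \<longleftrightarrow>
     (\<forall>R\<in>{0..1}. ereal R \<le> cov_radius D \<longrightarrow> (\<forall>x\<in>D. \<forall>y\<in>D. x \<noteq> y \<longrightarrow> F R \<le> dist x y))"
  by (simp only: controlled_by_def le_sep_radius_iff)

section \<open>Uniform discreteness and a description of the class\<close>

lemma r_discrete_iff:
  assumes "0 < r"
  shows "r_discrete r D \<longleftrightarrow> (\<forall>x\<in>D. \<forall>y\<in>D. x \<noteq> y \<longrightarrow> r \<le> dist x y)"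
proof
  assume sep: "\<forall>x\<in>D. \<forall>y\<in>D. x \<noteq> y \<longrightarrow> r \<le> dist x y"
  then have "uniform_discrete D"
    unfolding uniform_discrete_def using assms by (intro exI[of _ r]) fastforce
  with sep show "r_discrete r D"
    by (simp add: r_discrete_def uniform_discrete_imp_discrete)
qed (simp add: r_discrete_def)

lemma r_discrete_imp_closed:
  assumes "r_discrete r D" "0 < r"
  shows "closed D"
proof (rule uniform_discrete_imp_closed)
  show "uniform_discrete D"
    unfolding uniform_discrete_def
    using assms by (intro exI[of _ r]) (fastforce simp: r_discrete_def)
qed

text \<open>Replaces the Delone property by conditions that survive limits and treats the degenerate
  limit \<open>UNIV\<close> on the same footing as the other members.\<close>

lemma delone_sets_bar_eq:
  assumes F: "control_function F" and pos: "\<forall>R\<in>{0<..1}. F R > 0"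
  shows "delone_sets_bar F = {D. closed D \<and> cov_radius D \<le> 1 \<and> controlled_by F D}"
proof (intro equalityI subsetI)
  fix D :: "'a set" assume "D \<in> delone_sets_bar F"
  then consider "D \<in> delone_sets F" | "D = UNIV"
    unfolding delone_sets_bar_def by blast
  then show "D \<in> {D. closed D \<and> cov_radius D \<le> 1 \<and> controlled_by F D}"
  proof cases
    case 1
    then show ?thesis
      unfolding delone_sets_def delone_def
      using r_discrete_imp_closed by blast
  next
    case 2
    have "cov_radius (UNIV :: 'a set) \<le> ereal 0"
      unfolding cov_radius_le_iff by simp
    \<comment> \<open>Only \<open>R = 0\<close> is at most the covering radius, and
      \<open>F 0 = 0\<close> imposes nothing.\<close>
    moreover from this have "controlled_by F (UNIV :: 'a set)"
      using F unfolding controlled_by_iff control_function_def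
      by (metis atLeastAtMost_iff ereal_less_eq(3) order_antisym order_trans zero_le_dist)
    ultimately show ?thesis
      using 2 by (simp add: order_trans[of _ "0::ereal"] zero_ereal_def)
  qed
next
  fix D :: "'a set" assume "D \<in> {D. closed D \<and> cov_radius D \<le> 1 \<and> controlled_by F D}"
  then have D: "closed D" "cov_radius D \<le> 1" "controlled_by F D" by auto
  then obtain R where R: "cov_radius D = ereal R" "0 \<le> R" "R \<le> 1"
    using cov_radius_nonneg[of D] by (cases "cov_radius D") auto
  have ne: "D \<noteq> {}" and bound: "\<And>x. infdist x D \<le> R"
    using R(1) cov_radius_le_iff[of D R] by auto
  show "D \<in> delone_sets_bar F"
  proof (cases "R = 0")
    case True
    then have "x \<in> D" for x
      using bound[of x] infdist_nonneg[of x D] D(1) ne by (simp add: in_closed_iff_infdist_zero)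
    then show ?thesis
      unfolding delone_sets_bar_def by auto
  next
    case False
    then have "0 < F R" using R pos by simp
    \<comment> \<open>Control is applied at the covering radius \<open>R\<close> of \<open>D\<close>
      itself.\<close>
    moreover have "r_discrete (F R) D"
      using calculation D(3) R unfolding controlled_by_iff by (simp add: r_discrete_iff)
    \<comment> \<open>Any constant above 1 would serve: the strict inequality
      \<open>infdist x D < 2\<close> yields an actual point of \<open>D\<close>.\<close>
    moreover have "R_dense 2 D"
      unfolding R_dense_def
    proof
      fix x
      have "infdist x D < 2" using bound[of x] R by linarith
      then show "\<exists>y\<in>D. dist x y \<le> 2"
        using infdist_less_iff[OF ne] by (meson less_imp_le)
    qed
    ultimately have "delone D"
      unfolding delone_def by (meson zero_less_numeral)
    then show ?thesis
      unfolding delone_sets_bar_def delone_sets_def using D by blast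
  qed
qed

subsection \<open>The metric\<close>

lemma bdd_below_rho:
  "bdd_below ({e. e > 0 \<and> A \<inter> ball x0 (1 / e) \<subseteq> nbhd e B \<and> B \<inter> ball x0 (1 / e) \<subseteq> nbhd e A}
     \<union> {1::real})"
  by (auto intro!: bdd_belowI[of _ 0])

lemma rho_le:
  assumes "e > 0" "A \<inter> ball x0 (1 / e) \<subseteq> nbhd e B" "B \<inter> ball x0 (1 / e) \<subseteq> nbhd e A"
  shows "rho x0 A B \<le> e"
  unfolding rho_def using assms by (intro cInf_lower bdd_below_rho) auto

lemma rho_le_1: "rho x0 A B \<le> 1"
  unfolding rho_def by (intro cInf_lower bdd_below_rho) auto

lemma rho_nonneg: "0 \<le> rho x0 A B"
  unfolding rho_def by (intro cInf_greatest) auto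

lemma rho_commute: "rho x0 A B = rho x0 B A"
  unfolding rho_def by (simp add: conj_commute)

lemma nbhd_mono: "d \<le> e \<Longrightarrow> nbhd d A \<subseteq> nbhd e A"
  by (force simp: mem_nbhd_iff)

lemma subset_nbhd: "0 < e \<Longrightarrow> A \<subseteq> nbhd e A"
  by (force simp: mem_nbhd_iff)

text \<open>The defining condition persists when the radius grows, since the ball shrinks and the
  neighborhood widens. The bound \<open>e \<le> 1\<close> ensures that the witness below
  \<open>e\<close> is not the adjoined 1.\<close>

lemma rho_less_imp_subset:
  assumes "rho x0 A B < e" "e \<le> 1"
  shows "A \<inter> ball x0 (1 / e) \<subseteq> nbhd e B"
proof -
  obtain d where d: "d < e" "d > 0" "A \<inter> ball x0 (1 / d) \<subseteq> nbhd d B"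
    using assms unfolding rho_def by (subst (asm) cInf_less_iff[OF _ bdd_below_rho]) auto
  then have "ball x0 (1 / e) \<subseteq> ball x0 (1 / d)"
    by (intro subset_ball) (simp add: frac_le)
  with d nbhd_mono[of d e B] show ?thesis by auto
qed

lemma rho_eq_0_imp_subset:
  assumes "rho x0 A B = 0" "closed B"
  shows "A \<subseteq> B"
proof
  fix x assume "x \<in> A"
  have "\<exists>y\<in>B. dist y x < e" if "e > 0" for e
  proof -
    \<comment> \<open>The second term puts \<open>x\<close> strictly inside the ball of radius
      \<open>1 / d\<close>; its summand 1 also forces \<open>d \<le> 1\<close>.\<close>
    define d where "d = min e (1 / (dist x0 x + 1))"
    have d: "0 < d" "d \<le> e" "d \<le> 1 / (dist x0 x + 1)"
      using that by (auto simp: d_def add_nonneg_pos)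
    moreover have "1 / (dist x0 x + 1) \<le> 1" by (simp add: add_nonneg_pos)
    ultimately have "d \<le> 1" by linarith
    have "dist x0 x + 1 \<le> 1 / d"
      using d by (simp add: pos_le_divide_eq add_nonneg_pos mult.commute)
    then have "x \<in> ball x0 (1 / d)" by simp
    then have "x \<in> nbhd d B"
      using rho_less_imp_subset[of x0 A B d] \<open>d \<le> 1\<close> d(1) assms(1) \<open>x \<in> A\<close> by auto
    then show ?thesis
      using d(2) by (force simp: mem_nbhd_iff dist_commute)
  qed
  then show "x \<in> B"
    using assms(2) closed_approachable by blast
qed

text \<open>
  The cutoff at 1 is what makes the triangle inequality hold: \<open>1 / (a + b) + a \<le> 1 / b\<close> needs
  \<open>b * (a + b) \<le> 1\<close>.
\<close>

lemma ball_nbhd_trans: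
  assumes "0 < a" "0 < b" "a + b \<le> 1"
    and AB: "A \<inter> ball x0 (1 / a) \<subseteq> nbhd a B" and BC: "B \<inter> ball x0 (1 / b) \<subseteq> nbhd b C"
  shows "A \<inter> ball x0 (1 / (a + b)) \<subseteq> nbhd (a + b) C"
proof
  fix x assume x: "x \<in> A \<inter> ball x0 (1 / (a + b))"
  have "1 / (a + b) \<le> 1 / a" using assms by (simp add: frac_le)
  then obtain y where y: "y \<in> B" "dist x y < a"
    using x AB by (fastforce simp: mem_nbhd_iff)
  have "b * (a + b) \<le> 1"
    using assms by (intro mult_le_one) auto
  then have "a * (b * (a + b)) \<le> a"
    using assms by (simp add: mult_left_le)
  then have "1 / (a + b) + a \<le> 1 / b"
    using assms by (simp add: field_simps)
  moreover have "dist x0 y < 1 / (a + b) + a"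
    using x y(2) dist_triangle[of x0 y x] by auto
  ultimately obtain z where "z \<in> C" "dist y z < b"
    using BC y(1) by (fastforce simp: mem_nbhd_iff)
  then show "x \<in> nbhd (a + b) C"
    using y(2) dist_triangle[of x z y] unfolding mem_nbhd_iff by (intro bexI[of _ z]) auto
qed

lemma rho_triangle: "rho x0 A C \<le> rho x0 A B + rho x0 B C"
proof (rule field_le_epsilon)
  fix e :: real assume "0 < e"
  \<comment> \<open>The slack \<open>e / 2\<close> makes \<open>a\<close> and \<open>b\<close>
    positive and strictly larger than the two distances, as the inclusions require.\<close>
  define a b where "a = rho x0 A B + e / 2" and "b = rho x0 B C + e / 2"
  have ab: "rho x0 A B < a" "rho x0 B C < b"
    using \<open>0 < e\<close> by (auto simp: a_def b_def)
  then have pos: "0 < a" "0 < b"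
    using rho_nonneg by (meson le_less_trans)+
  have "rho x0 A C \<le> a + b"
  proof (cases "a + b \<le> 1")
    case True
    then have "a \<le> 1" "b \<le> 1" using pos by auto
    moreover have "rho x0 B A < a" "rho x0 C B < b" using ab by (simp_all add: rho_commute)
    ultimately have
      "A \<inter> ball x0 (1 / a) \<subseteq> nbhd a B" "B \<inter> ball x0 (1 / b) \<subseteq> nbhd b C"
      "C \<inter> ball x0 (1 / b) \<subseteq> nbhd b B" "B \<inter> ball x0 (1 / a) \<subseteq> nbhd a A"
      using ab by (simp_all only: rho_less_imp_subset)
    then have "A \<inter> ball x0 (1 / (a + b)) \<subseteq> nbhd (a + b) C"
      "C \<inter> ball x0 (1 / (b + a)) \<subseteq> nbhd (b + a) A"
      using True pos ball_nbhd_trans[of a b A x0 B C] ball_nbhd_trans[of b a C x0 B A]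
      by (simp_all only: add.commute)
    then show ?thesis
      using pos by (intro rho_le) (auto simp: add.commute)
  next
    \<comment> \<open>Here the cutoff suffices, as \<open>rho\<close> never exceeds 1.\<close>
    case False
    then show ?thesis using rho_le_1[of x0 A C] by linarith
  qed
  then show "rho x0 A C \<le> rho x0 A B + rho x0 B C + e"
    by (simp add: a_def b_def)
qed

text \<open>Closedness makes distance zero imply equality: a set and its closure are at distance
  0.\<close>

lemma Metric_space_rho:
  assumes "\<And>D. D \<in> M \<Longrightarrow> closed D"
  shows "Metric_space M (rho x0)"
proof
  fix A B assume "A \<in> M" "B \<in> M"
  have "rho x0 A A \<le> e" if "0 < e" for e
    using that using subset_nbhd by (intro rho_le) blast+
  then have "rho x0 A A = 0"
    using rho_nonneg[of x0 A A] by (meson antisym dense_ge)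
  moreover have "A = B" if "rho x0 A B = 0"
    using that rho_eq_0_imp_subset[of x0] rho_commute[of x0] assms \<open>A \<in> M\<close> \<open>B \<in> M\<close>
    by (metis subset_antisym)
  ultimately show "rho x0 A B = 0 \<longleftrightarrow> A = B" by blast
qed (rule rho_nonneg rho_commute rho_triangle)+

subsection \<open>Limits of distance functions\<close>

text \<open>Closed balls of integer radius exhaust the space, and each has finite nets of mesh
  \<open>1 / (m + 1)\<close>; their union is the countable set on which the diagonal argument
  runs.\<close>

lemma proper_metric_countable_dense:
  assumes "proper_metric TYPE('a::metric_space)"
  obtains S :: "'a::metric_space set" where "countable S" "\<And>x e. 0 < e \<Longrightarrow> \<exists>s\<in>S. dist x s < e"
proof -
  fix x0 :: 'a
  have "\<exists>K. finite K \<and> cball x0 (real n) \<subseteq> (\<Union>s\<in>K. ball s (inverse (Suc m)))" for n m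
    using assms unfolding proper_metric_def compact_eq_totally_bounded by auto
  then obtain K where fin: "\<And>n m. finite (K n m)"
    and K: "\<And>n m. cball x0 (real n) \<subseteq> (\<Union>s\<in>K n m. ball s (inverse (Suc m)))"
    by metis
  show ?thesis
  proof
    show "countable (\<Union>n m. K n m)"
      using fin by (intro countable_UN countableI_type countable_finite)
    fix x :: 'a and e :: real assume "0 < e"
    obtain n where "dist x0 x \<le> real n" using real_arch_simple by blast
    moreover obtain m where "inverse (Suc m) < e" using reals_Archimedean[OF \<open>0 < e\<close>] by blast
    ultimately show "\<exists>s\<in>(\<Union>n m. K n m). dist x s < e"
      using K[of n m] by (force simp: dist_commute)
  qed
qed

text \<open>The diagonal argument gives convergence on a countable dense set. Since all distance
  functions are 1-Lipschitz, the Cauchy property passes from a nearby point \<open>s\<close> to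
  \<open>x\<close> at a cost of two thirds of \<open>e\<close>.\<close>

lemma infdist_convergent_subsequence:
  fixes D :: "nat \<Rightarrow> 'a::metric_space set"
  assumes "proper_metric TYPE('a)" and bound: "\<And>n x. infdist x (D n) \<le> R"
  obtains k g where "strict_mono (k :: nat \<Rightarrow> nat)" "\<And>x. (\<lambda>n. infdist x (D (k n))) \<longlonglongrightarrow> g x"
proof -
  obtain S :: "'a set" where S: "countable S" "\<And>x e. 0 < e \<Longrightarrow> \<exists>s\<in>S. dist x s < e"
    using proper_metric_countable_dense[OF assms(1)] by blast
  obtain k where k: "strict_mono (k :: nat \<Rightarrow> nat)"
    "\<And>s. s \<in> S \<Longrightarrow> \<exists>l. (\<lambda>n. infdist s (D (k n))) \<longlonglongrightarrow> l"
    using function_convergent_subsequence[OF S(1), of "\<lambda>n x. infdist x (D n)" R] bound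
    by (auto simp: infdist_nonneg)
  have "convergent (\<lambda>n. infdist x (D (k n)))" for x
  proof -
    have "Cauchy (\<lambda>n. infdist x (D (k n)))"
      unfolding Cauchy_def
    proof (intro allI impI)
      fix e :: real assume "0 < e"
      then obtain s where s: "s \<in> S" "dist x s < e / 3" using S(2)[of "e / 3"] by auto
      then have "Cauchy (\<lambda>n. infdist s (D (k n)))"
        using k(2) LIMSEQ_imp_Cauchy by blast
      then obtain N where N: "\<And>m n. N \<le> m \<Longrightarrow> N \<le> n \<Longrightarrow>
          dist (infdist s (D (k m))) (infdist s (D (k n))) < e / 3"
        unfolding Cauchy_def using \<open>0 < e\<close> by (meson divide_pos_pos zero_less_numeral)
      have "dist (infdist x (D (k m))) (infdist x (D (k n))) < e" if "N \<le> m" "N \<le> n" for m n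
        using N[OF that] s(2) infdist_triangle_abs[of x "D (k m)" s]
          infdist_triangle_abs[of x "D (k n)" s]
        unfolding dist_real_def by linarith
      then show "\<exists>N. \<forall>m\<ge>N. \<forall>n\<ge>N. dist (infdist x (D (k m))) (infdist x (D (k n))) < e"
        by blast
    qed
    then show ?thesis by (rule Cauchy_convergent)
  qed
  then show ?thesis
    using that[OF k(1)] unfolding convergent_def by metis
qed

text \<open>\<open>L\<close> is the zero set of \<open>g\<close>. The limit \<open>g\<close> is
  1-Lipschitz, hence at most the distance to \<open>L\<close>. Conversely, almost nearest points of
  \<open>D n\<close> subconverge, by properness, to a zero of \<open>g\<close> within distance
  \<open>g x\<close>.\<close>

lemma infdist_limit_is_infdist:
  fixes D :: "nat \<Rightarrow> 'a::metric_space set"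
  assumes proper: "proper_metric TYPE('a)" and ne: "\<And>n. D n \<noteq> {}"
    and lim: "\<And>x. (\<lambda>n. infdist x (D n)) \<longlonglongrightarrow> g x"
  obtains L where "closed L" "L \<noteq> {}" "\<And>x. g x = infdist x L"
proof -
  have lip: "g x \<le> g y + dist x y" for x y
    using infdist_triangle by (intro LIMSEQ_le[OF lim tendsto_add[OF lim tendsto_const]]) blast
  have nonneg: "0 \<le> g x" for x
    by (rule LIMSEQ_le_const[OF lim]) (simp add: infdist_nonneg)
  define L where "L = {x. g x = 0}"
  have nearest: "\<exists>y\<in>L. dist x y \<le> g x" for x
  proof -
    \<comment> \<open>The distance to \<open>D n\<close> need not be attained, so an error tending
      to 0 is allowed.\<close>
    have "\<exists>y\<in>D n. dist x y < infdist x (D n) + inverse (Suc n)" for n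
      using ne[of n] infdist_less_iff[of "D n"] by (metis inverse_positive_iff_positive
          less_add_same_cancel1 of_nat_0_less_iff zero_less_Suc)
    then obtain y where y: "\<And>n. y n \<in> D n" "\<And>n. dist x (y n) < infdist x (D n) + inverse (Suc n)"
      by metis
    have lim': "(\<lambda>n. infdist x (D n) + inverse (Suc n)) \<longlonglongrightarrow> g x"
      using tendsto_add[OF lim LIMSEQ_inverse_real_of_nat] by simp
    then obtain B where "\<And>n. infdist x (D n) + inverse (Suc n) \<le> B"
      using BseqE[OF convergent_imp_Bseq[OF convergentI[OF lim']]] abs_le_D1
      unfolding real_norm_def by meson
    then have "dist x (y n) \<le> B" for n
      using y(2)[of n] order_less_imp_le order_trans by blast
    then have "y n \<in> cball x B" for n by simp
    moreover have "compact (cball x B)"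
      using proper unfolding proper_metric_def by blast
    ultimately obtain z r where r: "strict_mono (r :: nat \<Rightarrow> nat)" and z: "(y \<circ> r) \<longlonglongrightarrow> z"
      unfolding compact_def by metis
    \<comment> \<open>Points of \<open>D (r n)\<close> converge to \<open>z\<close>, which forces
      \<open>g z = 0\<close>.\<close>
    have "infdist z (D (r n)) \<le> dist z (y (r n))" for n
      using y(1) by (rule infdist_le)
    moreover have "(\<lambda>n. dist z (y (r n))) \<longlonglongrightarrow> dist z z"
      using z unfolding comp_def by (intro tendsto_intros)
    moreover have "(\<lambda>n. infdist z (D (r n))) \<longlonglongrightarrow> g z"
      using LIMSEQ_subseq_LIMSEQ[OF lim r] by (simp add: comp_def)
    ultimately have "g z \<le> dist z z"
      by (intro LIMSEQ_le) auto
    then have "z \<in> L" using nonneg[of z] by (simp add: L_def)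
    moreover have "dist x z \<le> g x"
    proof (rule LIMSEQ_le)
      show "(\<lambda>n. dist x (y (r n))) \<longlonglongrightarrow> dist x z"
        using z unfolding comp_def by (intro tendsto_intros)
      show "(\<lambda>n. infdist x (D (r n)) + inverse (Suc (r n))) \<longlonglongrightarrow> g x"
        using LIMSEQ_subseq_LIMSEQ[OF lim' r] by (simp add: comp_def)
      show "\<exists>N. \<forall>n\<ge>N. dist x (y (r n)) \<le> infdist x (D (r n)) + inverse (Suc (r n))"
        using y(2) by (meson less_imp_le)
    qed
    ultimately show ?thesis by blast
  qed
  have "L \<noteq> {}" using nearest by blast
  have g: "g x = infdist x L" for x
  proof (rule antisym)
    show "infdist x L \<le> g x"
      using nearest[of x] infdist_le2 by blast
    show "g x \<le> infdist x L"
      unfolding infdist_notempty[OF \<open>L \<noteq> {}\<close>]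
    proof (rule cINF_greatest[OF \<open>L \<noteq> {}\<close>])
      fix a assume "a \<in> L"
      then show "g x \<le> dist x a" using lip[of x a] by (simp add: L_def)
    qed
  qed
  \<comment> \<open>Every point of the closure has \<open>infdist\<close> 0 to \<open>L\<close>,
    hence is a zero of \<open>g\<close>.\<close>
  have "closed L"
    using \<open>L \<noteq> {}\<close> g in_closure_iff_infdist_zero[of L] unfolding L_def
    by (metis (mono_tags, lifting) closure_subset_eq mem_Collect_eq subsetI)
  with \<open>L \<noteq> {}\<close> g show ?thesis using that by blast
qed

text \<open>Pointwise convergence on a finite \<open>e / 3\<close>-net of the ball suffices; the
  Lipschitz bounds for \<open>D n\<close> and for \<open>L\<close> cost another third each.\<close>

lemma infdist_locally_uniform:
  fixes D :: "nat \<Rightarrow> 'a::metric_space set"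
  assumes proper: "proper_metric TYPE('a)"
    and lim: "\<And>x. (\<lambda>n. infdist x (D n)) \<longlonglongrightarrow> infdist x L" and "0 < e"
  shows "\<forall>\<^sub>F n in sequentially. \<forall>x\<in>ball x0 r. \<bar>infdist x (D n) - infdist x L\<bar> < e"
proof -
  have "compact (cball x0 r)" using proper unfolding proper_metric_def by blast
  moreover have "0 < e / 3" using \<open>0 < e\<close> by simp
  ultimately obtain K where "finite K" and K: "cball x0 r \<subseteq> (\<Union>s\<in>K. ball s (e / 3))"
    unfolding compact_eq_totally_bounded by meson
  have "\<forall>\<^sub>F n in sequentially. \<bar>infdist s (D n) - infdist s L\<bar> < e / 3" for s
    using tendstoD[OF lim \<open>0 < e / 3\<close>] by (simp add: dist_real_def)
  then have "\<forall>\<^sub>F n in sequentially. \<forall>s\<in>K. \<bar>infdist s (D n) - infdist s L\<bar> < e / 3"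
    using \<open>finite K\<close> by (simp add: eventually_ball_finite)
  then show ?thesis
  proof (rule eventually_mono, intro ballI)
    fix n x assume n: "\<forall>s\<in>K. \<bar>infdist s (D n) - infdist s L\<bar> < e / 3" and "x \<in> ball x0 r"
    then obtain s where "s \<in> K" "dist x s < e / 3"
      using K by (force simp: dist_commute)
    moreover from this n have "\<bar>infdist s (D n) - infdist s L\<bar> < e / 3" by blast
    ultimately show "\<bar>infdist x (D n) - infdist x L\<bar> < e"
      using infdist_triangle_abs[of x "D n" s] infdist_triangle_abs[of x L s] by linarith
  qed
qed

text \<open>A point of one set has distance 0 to it, so on a ball where the two distance functions
  differ by less than \<open>d\<close> it lies in the \<open>d\<close>-neighborhood of the other
  set.\<close>

lemma rho_tendsto:
  fixes D :: "nat \<Rightarrow> 'a::metric_space set"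
  assumes "proper_metric TYPE('a)"
    and "\<And>n. D n \<noteq> {}" "L \<noteq> {}"
    and "\<And>x. (\<lambda>n. infdist x (D n)) \<longlonglongrightarrow> infdist x L" and "0 < e"
  shows "\<forall>\<^sub>F n in sequentially. rho x0 (D n) L < e"
proof -
  define d where "d = e / 2"
  have d: "0 < d" "d < e" using \<open>0 < e\<close> by (auto simp: d_def)
  show ?thesis
    using infdist_locally_uniform[OF assms(1,4) d(1)]
  proof (rule eventually_mono)
    fix n assume n: "\<forall>x\<in>ball x0 (1 / d). \<bar>infdist x (D n) - infdist x L\<bar> < d"
    have "rho x0 (D n) L \<le> d"
      using n d(1) assms(2,3) by (intro rho_le) (auto simp: nbhd_eq_infdist)
    with d(2) show "rho x0 (D n) L < e" by linarith
  qed
qed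

text \<open>
  Control of \<open>L\<close> at a radius \<open>R\<close> is obtained from control of \<open>D n\<close> at radii \<open>R' < R\<close>, since the
  covering radius of \<open>D n\<close> may stay below that of \<open>L\<close>; continuity of \<open>F\<close> then gives \<open>R' \<rightarrow> R\<close>.
\<close>

lemma controlled_by_limit:
  fixes D :: "nat \<Rightarrow> 'a::metric_space set"
  assumes F: "control_function F"
    and ne: "\<And>n. D n \<noteq> {}" and "L \<noteq> {}"
    and lim: "\<And>x. (\<lambda>n. infdist x (D n)) \<longlonglongrightarrow> infdist x L"
    and ctrl: "\<And>n. controlled_by F (D n)"
  shows "controlled_by F L"
  unfolding controlled_by_iff
proof (intro ballI impI)
  fix R x y
  assume R: "R \<in> {0..1}" "ereal R \<le> cov_radius L" and xy: "x \<in> L" "y \<in> L" "x \<noteq> y"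
  have below: "F R' \<le> dist x y" if R': "0 \<le> R'" "R' < R" for R'
  proof (rule field_le_epsilon)
    fix e :: real assume "0 < e"
    \<comment> \<open>Moving both points by less than \<open>d\<close> changes their distance by
      less than \<open>e\<close> and keeps them distinct.\<close>
    define d where "d = min (e / 2) (dist x y / 2)"
    have d: "0 < d" "2 * d \<le> e" "2 * d \<le> dist x y"
      using \<open>0 < e\<close> xy(3) by (auto simp: d_def min_def)
    have "\<not> cov_radius L \<le> ereal R'"
      using R(2) R'(2) by (meson ereal_less_eq(3) not_le order_trans)
    \<comment> \<open>A single point witnesses that the covering radius of \<open>L\<close> exceeds
      \<open>R'\<close>; the strict inequality persists for large \<open>n\<close>.\<close>
    then obtain z where "R' < infdist z L"
      using \<open>L \<noteq> {}\<close> unfolding cov_radius_le_iff by (auto simp: not_le)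
    then have "\<forall>\<^sub>F n in sequentially. R' < infdist z (D n)"
      using lim order_tendstoD(1) by blast
    moreover have "\<forall>\<^sub>F n in sequentially. infdist x (D n) < d"
      using order_tendstoD(2)[OF lim] d(1) xy(1) by (metis infdist_zero)
    moreover have "\<forall>\<^sub>F n in sequentially. infdist y (D n) < d"
      using order_tendstoD(2)[OF lim] d(1) xy(2) by (metis infdist_zero)
    ultimately have "\<forall>\<^sub>F n in sequentially.
        R' < infdist z (D n) \<and> infdist x (D n) < d \<and> infdist y (D n) < d"
      by (intro eventually_conj)
    then obtain n where n: "R' < infdist z (D n)" "infdist x (D n) < d" "infdist y (D n) < d"
      using eventually_happens'[OF sequentially_bot] by blast
    then obtain x' y' where x': "x' \<in> D n" "dist x x' < d" and y': "y' \<in> D n" "dist y y' < d"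
      unfolding infdist_less_iff[OF ne] by blast
    have tri: "dist x y \<le> dist x x' + dist x' y' + dist y y'"
      "dist x' y' \<le> dist x x' + dist x y + dist y y'"
      using dist_triangle[of x y x'] dist_triangle[of x' y y'] dist_triangle[of x' y' x]
        dist_triangle[of x y' y]
      by (simp_all add: dist_commute)
    have "x' \<noteq> y'"
      using tri(1) x'(2) y'(2) d(3) by auto
    moreover have "ereal R' \<le> cov_radius (D n)"
      using n(1) cov_radius_le_iff[of "D n" R'] by (meson linear not_le)
    ultimately have "F R' \<le> dist x' y'"
      using ctrl[of n] R' R(1) x'(1) y'(1) unfolding controlled_by_iff by auto
    then show "F R' \<le> dist x y + e"
      using tri(2) x'(2) y'(2) d(2) by linarith
  qed
  show "F R \<le> dist x y"
  proof (cases "R = 0")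
    case True
    then show ?thesis using F unfolding control_function_def by simp
  next
    case False
    define a where "a n = R * (1 - inverse (Suc n))" for n
    have a: "0 \<le> a n" "a n < R" for n
      using False R(1) by (auto simp: a_def field_simps)
    have "a \<longlonglongrightarrow> R * (1 - 0)"
      unfolding a_def by (intro tendsto_intros LIMSEQ_inverse_real_of_nat)
    then have lim_a: "a \<longlonglongrightarrow> R" by simp
    have cont: "continuous_on {0..1} F" using F unfolding control_function_def by blast
    have "a n \<in> {0..1}" for n
      using a[of n] R(1) by auto
    then have "(\<lambda>n. F (a n)) \<longlonglongrightarrow> F R"
      by (intro continuous_on_tendsto_compose[OF cont lim_a R(1)] always_eventually allI)
    then show ?thesis
      by (rule LIMSEQ_le_const2) (use below a in blast)
  qed
qed

section \<open>Sequential compactness of the class\<close>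

theorem theorem1p2:
  fixes x0 :: "'a::metric_space" and F :: "real \<Rightarrow> real"
  assumes "control_function F"
    and "\<forall>R\<in>{0<..1}. F R > 0"
    and "proper_metric TYPE('a)"
  shows "Metric_space (delone_sets_bar F :: 'a set set) (rho x0) \<and>
         compact_space (Metric_space.mtopology (delone_sets_bar F :: 'a set set) (rho x0))"
proof
  let ?M = "delone_sets_bar F :: 'a set set"
  note M_eq = delone_sets_bar_eq[OF assms(1,2), where 'a = 'a]
  show metric: "Metric_space ?M (rho x0)"
    by (rule Metric_space_rho) (simp add: M_eq)
  interpret Metric_space ?M "rho x0" by (fact metric)
  show "compact_space mtopology"
    unfolding compact_space_sequentially
  proof (intro allI impI)
    fix D :: "nat \<Rightarrow> 'a set" assume "range D \<subseteq> ?M"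
    then have D: "D n \<in> ?M" for n by blast
    then have cov: "cov_radius (D n) \<le> ereal 1" and ctrl: "controlled_by F (D n)" for n
      by (auto simp: M_eq one_ereal_def)
    then have ne: "D n \<noteq> {}" and bound: "infdist x (D n) \<le> 1" for n x
      by (auto simp: cov_radius_le_iff simp del: ereal_eq_1)
    obtain k g where k: "strict_mono (k :: nat \<Rightarrow> nat)"
      and g: "\<And>x. (\<lambda>n. infdist x (D (k n))) \<longlonglongrightarrow> g x"
      by (rule infdist_convergent_subsequence[OF assms(3) bound]) (rule that)
    obtain L where L: "closed L" "L \<noteq> {}" and gL: "\<And>x. g x = infdist x L"
      by (rule infdist_limit_is_infdist[OF assms(3) ne g]) (rule that)
    note lim = g[unfolded gL]
    have "infdist x L \<le> 1" for x
      using bound by (intro LIMSEQ_le_const2[OF lim]) blast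
    then have "cov_radius L \<le> ereal 1"
      using L(2) unfolding cov_radius_le_iff by blast
    moreover have "controlled_by F L"
      using controlled_by_limit[OF assms(1) ne L(2) lim ctrl] .
    \<comment> \<open>The description of the class covers the case \<open>L = UNIV\<close> as
      well.\<close>
    ultimately have "L \<in> ?M"
      using L(1) by (simp add: M_eq one_ereal_def)
    moreover from this have "limitin mtopology (D \<circ> k) L sequentially"
      using rho_tendsto[OF assms(3) ne L(2) lim] D by (simp add: limitin_metric)
    ultimately show "\<exists>L r. L \<in> ?M \<and> strict_mono r \<and> limitin mtopology (D \<circ> r) L sequentially"
      using k by blast
  qed
qed

end
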